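(* Let $(P,\le,* )$ be a relatively pseudocomplemented poset, let $D\subseteq P$ and let $\Theta$ be a congruence on $(P,\le,* )$. Define the terms $t_1:=1$ (a constant) and $t_2(x,y_1,y_2):=\big(y_1*(y_2*x)\big)*x$. Then: (i) $t_1$ and $t_2$ are ideal terms (in the variables $y_1,y_2$ for $t_2$), i.e. $t_1=1$ and $t_2(a,1,1)=1$ for all $a\in P$; (ii) if $D$ is closed with respect to $t_1$ and $t_2$ (i.e. $1\in D$, and $t_2(a,b_1,b_2)\in D$ for all $a\in P$ and all $b_1,b_2\in D$), then $D$ is a deductive system of $(P,\le,* )$; (iii) $[1]\Theta$ is closed with respect to $t_1$ and $t_2$.
   Context: For a poset $(P,\le)$ and $x,y\in P$ let $L(x,y)=\{z\in P\mid z\le x,\ z\le y\}$ and $U(x,y)=\{z\in P\mid x\le z,\ y\le z\}$; $\operatorname{Max}A$, $\operatorname{Min}A$ are the sets of maximal, minimal elements of $A$. A poset is relatively pseudocomplemented if for all $x,y\in P$ there exists a greatest element $z$ of $P$ such that every element of $L(x,z)$ is $\le y$; this $z$ is denoted $x*y$; such a poset has a greatest element $1$. A binary relation $R$ is compatible with a map $Q\colon P^2\to 2^P$ if whenever $(a_1,b_1),(a_2,b_2)\in R$ there exist $a\in Q(a_1,a_2)$, $b\in Q(b_1,b_2)$ with $(a,b)\in R$. A congruence on $(P,\le,* )$ is an equivalence relation compatible with $(x,y)\mapsto\operatorname{Max}L(x,y)$, $(x,y)\mapsto\operatorname{Min}U(x,y)$, and with $*$ (i.e. $(a_1,b_1),(a_2,b_2)\in\Theta$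 imply $(a_1*a_2,b_1*b_2)\in\Theta$). A deductive system is a subset $D\subseteq P$ with $1\in D$ such that $x\in D$, $y\in P$, $x*y\in D$ imply $y\in D$. *)

theory Defs
  imports Main
begin

definition lower_cone :: "'a::order \<Rightarrow> 'a \<Rightarrow> 'a set" where
  "lower_cone x y = {z. z \<le> x \<and> z \<le> y}"

definition upper_cone :: "'a::order \<Rightarrow> 'a \<Rightarrow> 'a set" where
  "upper_cone x y = {z. x \<le> z \<and> y \<le> z}"

definition maximal_elements :: "'a::order set \<Rightarrow> 'a set" where
  "maximal_elements A = {x \<in> A. \<forall>y\<in>A. x \<le> y \<longrightarrow> y = x}"

definition minimal_elements :: "'a::order set \<Rightarrow> 'a set" where
  "minimal_elements A = {x \<in> A. \<forall>y\<in>A. y \<le> x \<longrightarrow> y = x}"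

text \<open>The poset \<open>P\<close> is the whole type. The set \<open>{w. w \<le> x \<and> w \<le> z}\<close>
  is \<open>L(x,z)\<close>, unfolded because it occurs inside the class specification.\<close>

class rel_pseudocomplemented_poset = order +
  assumes ex_greatest_rel_pc:
    "\<exists>z. (\<forall>w\<in>{w. w \<le> x \<and> w \<le> z}. w \<le> y) \<and>
         (\<forall>z'. (\<forall>w\<in>{w. w \<le> x \<and> w \<le> z'}. w \<le> y) \<longrightarrow> z' \<le> z)"

definition rel_pc :: "'a::rel_pseudocomplemented_poset \<Rightarrow> 'a \<Rightarrow> 'a"  (infixl "\<star>" 70) where
  "x \<star> y = (GREATEST z. \<forall>w\<in>lower_cone x z. w \<le> y)"

definition greatest_element :: "'a::rel_pseudocomplemented_poset"  ("\<one>") where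
  "\<one> = (GREATEST z. True)"

lemma rel_pc_lower: "w \<in> lower_cone x (x \<star> y) \<Longrightarrow> w \<le> y"
  and rel_pc_greatest: "(\<And>w. w \<in> lower_cone x z \<Longrightarrow> w \<le> y) \<Longrightarrow> z \<le> x \<star> y"
proof -
  obtain g where g: "\<forall>w\<in>lower_cone x g. w \<le> y"
    "\<And>z'. \<forall>w\<in>lower_cone x z'. w \<le> y \<Longrightarrow> z' \<le> g"
    using ex_greatest_rel_pc[of x y] unfolding lower_cone_def by blast
  have eq: "x \<star> y = g"
    unfolding rel_pc_def by (rule Greatest_equality) (use g in auto)
  show "w \<in> lower_cone x (x \<star> y) \<Longrightarrow> w \<le> y"
    using g(1) eq by blast
  show "(\<And>w. w \<in> lower_cone x z \<Longrightarrow> w \<le> y) \<Longrightarrow> z \<le> x \<star> y"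
    using g(2) eq by blast
qed

lemma le_greatest_element: "x \<le> \<one>"
proof -
  fix a :: 'a
  have le: "z \<le> a \<star> a" for z
    by (rule rel_pc_greatest) (simp add: lower_cone_def)
  have "\<one> = a \<star> a"
    unfolding greatest_element_def by (rule Greatest_equality) (use le in auto)
  then show "x \<le> \<one>" using le by simp
qed

definition compatible :: "('a \<times> 'a) set \<Rightarrow> ('a \<Rightarrow> 'a \<Rightarrow> 'a set) \<Rightarrow> bool" where
  "compatible R Q \<longleftrightarrow>
    (\<forall>a1 b1 a2 b2. (a1, b1) \<in> R \<and> (a2, b2) \<in> R \<longrightarrow>
      (\<exists>a\<in>Q a1 a2. \<exists>b\<in>Q b1 b2. (a, b) \<in> R))"

definition congruence :: "('a::rel_pseudocomplemented_poset \<times> 'a) set \<Rightarrow> bool" where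
  "congruence \<Theta> \<longleftrightarrow>
    equiv UNIV \<Theta> \<and>
    compatible \<Theta> (\<lambda>x y. maximal_elements (lower_cone x y)) \<and>
    compatible \<Theta> (\<lambda>x y. minimal_elements (upper_cone x y)) \<and>
    (\<forall>a1 b1 a2 b2. (a1, b1) \<in> \<Theta> \<and> (a2, b2) \<in> \<Theta> \<longrightarrow> (a1 \<star> a2, b1 \<star> b2) \<in> \<Theta>)"

definition deductive_system :: "'a::rel_pseudocomplemented_poset set \<Rightarrow> bool" where
  "deductive_system D \<longleftrightarrow> \<one> \<in> D \<and> (\<forall>x\<in>D. \<forall>y. x \<star> y \<in> D \<longrightarrow> y \<in> D)"

definition t1 :: "'a::rel_pseudocomplemented_poset" where
  "t1 = \<one>"

definition t2 :: "'a::rel_pseudocomplemented_poset \<Rightarrow> 'a \<Rightarrow> 'a \<Rightarrow> 'a" where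
  "t2 x y1 y2 = (y1 \<star> (y2 \<star> x)) \<star> x"

definition closed_t1_t2 :: "'a::rel_pseudocomplemented_poset set \<Rightarrow> bool" where
  "closed_t1_t2 D \<longleftrightarrow> t1 \<in> D \<and> (\<forall>a. \<forall>b1\<in>D. \<forall>b2\<in>D. t2 a b1 b2 \<in> D)"

end

theory Submission
  imports Defs
begin

text \<open>The identities \<open>x \<star> x = \<one>\<close> and \<open>\<one> \<star> x = x\<close> give \<open>t2 a \<one> \<one> = \<one>\<close> and
  \<open>t2 y (x \<star> y) x = \<one> \<star> y = y\<close>; the latter turns closedness under \<open>t2\<close> into modus ponens.
  A congruence identifies \<open>t2 a b1 b2\<close> with \<open>t2 a \<one> \<one> = \<one>\<close> whenever it identifies
  \<open>b1\<close> and \<open>b2\<close> with \<open>\<one>\<close>.\<close>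

lemma rel_pc_self: "x \<star> x = \<one>"
  by (rule order.antisym[OF le_greatest_element rel_pc_greatest]) (simp add: lower_cone_def)

text \<open>Since \<open>\<one>\<close> is the top, \<open>lower_cone \<one> z\<close> consists of
  all elements below \<open>z\<close>, so it is bounded by \<open>x\<close> exactly when
  \<open>z \<le> x\<close>.\<close>

lemma rel_pc_one_left: "\<one> \<star> x = x"
proof (rule order.antisym)
  show "\<one> \<star> x \<le> x"
    by (rule rel_pc_lower[of _ \<one>]) (simp add: lower_cone_def le_greatest_element)
  show "x \<le> \<one> \<star> x"
    by (rule rel_pc_greatest) (simp add: lower_cone_def)
qed

lemma t2_one_one: "t2 a \<one> \<one> = \<one>"
  by (simp add: t2_def rel_pc_one_left rel_pc_self)

text \<open>The inner term is \<open>(x \<star> y) \<star> (x \<star> y)\<close>, hence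
  \<open>\<one>\<close>.\<close>

lemma t2_rel_pc: "t2 y (x \<star> y) x = y"
  by (simp add: t2_def rel_pc_one_left rel_pc_self)

lemma closed_t1_t2_imp_deductive_system:
  assumes "closed_t1_t2 D"
  shows "deductive_system D"
  unfolding deductive_system_def
proof (intro conjI ballI allI impI)
  show "\<one> \<in> D"
    using assms by (simp add: closed_t1_t2_def t1_def)
  fix x y
  assume "x \<in> D" "x \<star> y \<in> D"
  then have "t2 y (x \<star> y) x \<in> D"
    using assms by (simp add: closed_t1_t2_def)
  then show "y \<in> D"
    by (simp add: t2_rel_pc)
qed

lemma congruence_t2:
  assumes "congruence \<Theta>" "(b1, c1) \<in> \<Theta>" "(b2, c2) \<in> \<Theta>"
  shows "(t2 a b1 b2, t2 a c1 c2) \<in> \<Theta>"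
proof -
  \<comment> \<open>Reflexivity covers the fixed parameter \<open>a\<close>; compatibility with
    \<open>\<star>\<close> is then applied three times, once per \<open>\<star>\<close> in
    \<open>t2\<close>.\<close>
  have "(a, a) \<in> \<Theta>"
    using assms(1) by (auto simp: congruence_def equiv_def refl_on_def)
  then show ?thesis
    using assms unfolding congruence_def t2_def by blast
qed

lemma closed_t1_t2_congruence_class_one:
  assumes "congruence \<Theta>"
  shows "closed_t1_t2 (\<Theta> `` {\<one>})"
proof -
  have "(\<one>, \<one>) \<in> \<Theta>"
    using assms by (auto simp: congruence_def equiv_def refl_on_def)
  moreover have "(\<one>, t2 a b1 b2) \<in> \<Theta>" if "(\<one>, b1) \<in> \<Theta>" "(\<one>, b2) \<in> \<Theta>" for a b1 b2
    \<comment> \<open>The left component is \<open>t2 a \<one> \<one>\<close>, which collapses to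
      \<open>\<one>\<close>.\<close>
    using congruence_t2[OF assms that, of a] by (simp add: t2_one_one)
  ultimately show ?thesis
    by (simp add: closed_t1_t2_def t1_def)
qed

theorem theorem4p10:
  fixes D :: "'a::rel_pseudocomplemented_poset set"
    and \<Theta> :: "('a \<times> 'a) set"
  assumes "congruence \<Theta>"
  shows "((t1 :: 'a) = \<one> \<and> (\<forall>a::'a. t2 a \<one> \<one> = \<one>)) \<and>
    (closed_t1_t2 D \<longrightarrow> deductive_system D) \<and>
    closed_t1_t2 (\<Theta> `` {\<one>})"
  using assms
  by (simp add: t1_def t2_one_one closed_t1_t2_imp_deductive_system
      closed_t1_t2_congruence_class_one)

end
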